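(* The fixed point $\eta$ of $\tau$, considered as a map from $\mathbb N\cup\{0\}$ to $\{a,x,y,z\}$, agrees with the sequence $\mathcal A_{q_0}$ generated by the automaton $\mathcal A$ with initial state $q_0$.
   Context: Let $\tau$ be the substitution on $\{a,x,y,z\}$ with $a\mapsto axa$, $x\mapsto y$, $y\mapsto z$, $z\mapsto x$, extended to words by concatenation. $\eta$ is the unique one-sided infinite word having $\tau^n(a)$ as a prefix for every $n\ge 0$; viewed as a map on $\mathbb N\cup\{0\}$, $\eta(0)$ is its first letter, $\eta(1)$ the second, and so on. The automaton $\mathcal A$ works over the input alphabet $\{0,1\}$ and has four states $q_0,q_1,q_2,q_3$ labeled by $a,x,y,z$ respectively. Reading $0$ leads from any state to $q_0$; reading $1$ leads from $q_0$ to $q_1$, from $q_1$ to $q_2$, from $q_2$ to $q_3$, and from $q_3$ to $q_1$. The sequence $\mathcal A_{q_0}:\mathbb N\cup\{0\}\to\{a,x,y,z\}$ is defined as follows: write $n$ in binary as $n=x_02^i+x_12^{i-1}+\dots+x_{i-1}2+x_i$ with $i\ge0$ and $x_j\in\{0,1\}$; follow the path in the automaton starting at $q_0$ and reading $x_0,x_1,\dots,x_i$ in this order; $\mathcal A_{q_0}(n)$ is the label of the state where this path ends. *)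

theory Defs
  imports "HOL-Library.Omega_Words_Fun"
begin

datatype letter = A | X | Y | Z

fun \<tau>_letter :: "letter \<Rightarrow> letter list" where
  "\<tau>_letter A = [A, X, A]"
| "\<tau>_letter X = [Y]"
| "\<tau>_letter Y = [Z]"
| "\<tau>_letter Z = [X]"

definition \<tau> :: "letter list \<Rightarrow> letter list" where
  "\<tau> w = concat (map \<tau>_letter w)"

text \<open>One-sided infinite words are functions on \<^typ>\<open>nat\<close> (the type synonym \<open>word\<close> of the library);
  \<open>prefix k w\<close> is the list of the first \<open>k\<close> letters of \<open>w\<close>.\<close>

definition is_prefix :: "'a list \<Rightarrow> 'a word \<Rightarrow> bool" where
  "is_prefix u w \<longleftrightarrow> prefix (length u) w = u"

definition \<eta> :: "letter word" where
  "\<eta> = (THE w. \<forall>n. is_prefix ((\<tau> ^^ n) [A]) w)"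

datatype state = q0 | q1 | q2 | q3

fun label :: "state \<Rightarrow> letter" where
  "label q0 = A"
| "label q1 = X"
| "label q2 = Y"
| "label q3 = Z"

text \<open>The input alphabet is \<^typ>\<open>bool\<close>, with \<^term>\<open>False\<close> for the digit 0 and \<^term>\<open>True\<close>
  for the digit 1.\<close>

fun step :: "state \<Rightarrow> bool \<Rightarrow> state" where
  "step q False = q0"
| "step q0 True = q1"
| "step q1 True = q2"
| "step q2 True = q3"
| "step q3 True = q1"

definition run :: "state \<Rightarrow> bool list \<Rightarrow> state" where
  "run q ds = foldl step q ds"

text \<open>The most significant digit comes first. Leading zeros are permitted, so the expansion of a
  number is not unique.\<close>

definition digits_value :: "bool list \<Rightarrow> nat" where
  "digits_value ds = (\<Sum>j<length ds. of_bool (ds ! j) * 2 ^ (length ds - 1 - j))"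

definition binary_expansion :: "nat \<Rightarrow> bool list \<Rightarrow> bool" where
  "binary_expansion n ds \<longleftrightarrow> ds \<noteq> [] \<and> n = digits_value ds"

text \<open>Meant for the initial state \<^term>\<open>q0\<close>: reading 0 does not leave it, so that the value does not
  depend on leading zeros (see \<open>automaton_seq_well_defined\<close>); for \<^term>\<open>q1\<close> and \<^term>\<open>q2\<close> it would.\<close>

definition automaton_seq :: "state \<Rightarrow> nat \<Rightarrow> letter" where
  "automaton_seq q n = (THE s. \<exists>ds. binary_expansion n ds \<and> s = label (run q ds))"


subsection \<open>The descriptions defining \<open>\<eta>\<close> and \<open>automaton_seq\<close> are proper\<close>

lemma \<tau>_append: "\<tau> (u @ v) = \<tau> u @ \<tau> v"
  by (simp add: \<tau>_def)

lemma \<tau>_pow_append: "(\<tau> ^^ n) (u @ v) = (\<tau> ^^ n) u @ (\<tau> ^^ n) v"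
  by (induction n) (simp_all add: \<tau>_append)

lemma \<tau>_pow_Suc: "(\<tau> ^^ Suc n) [A] = (\<tau> ^^ n) [A] @ (\<tau> ^^ n) [X] @ (\<tau> ^^ n) [A]"
proof -
  have "(\<tau> ^^ Suc n) [A] = (\<tau> ^^ n) ([A] @ [X] @ [A])"
    by (simp add: funpow_Suc_right \<tau>_def del: funpow.simps)
  then show ?thesis
    by (simp only: \<tau>_pow_append)
qed

lemma length_\<tau>_pow: "n < length ((\<tau> ^^ n) [A])"
proof (induction n)
  case (Suc n)
  then show ?case
    by (simp only: \<tau>_pow_Suc length_append)
qed simp

lemma \<tau>_pow_nth_mono:
  assumes "m \<le> n" "k < length ((\<tau> ^^ m) [A])"
  shows "(\<tau> ^^ n) [A] ! k = (\<tau> ^^ m) [A] ! k \<and> k < length ((\<tau> ^^ n) [A])"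
  using assms(1)
proof (induction n rule: dec_induct)
  case (step n)
  then show ?case
    by (simp only: \<tau>_pow_Suc length_append nth_append if_True) simp
qed (use assms(2) in simp)

lemma is_prefix_iff: "is_prefix u w \<longleftrightarrow> (\<forall>k<length u. w k = u ! k)"
  unfolding is_prefix_def by (subst list_eq_iff_nth_eq) simp

lemma \<eta>_well_defined: "\<exists>!w. \<forall>n. is_prefix ((\<tau> ^^ n) [A]) w"
proof (rule ex1I)
  show "\<forall>n. is_prefix ((\<tau> ^^ n) [A]) (\<lambda>k. (\<tau> ^^ k) [A] ! k)"
    unfolding is_prefix_iff
  proof (intro allI impI)
    fix n k
    assume "k < length ((\<tau> ^^ n) [A])"
    then show "(\<tau> ^^ k) [A] ! k = (\<tau> ^^ n) [A] ! k"
      using \<tau>_pow_nth_mono[of n k k] \<tau>_pow_nth_mono[of k n k] length_\<tau>_pow[of k]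
      by (cases "n \<le> k") simp_all
  qed
next
  fix w
  assume "\<forall>n. is_prefix ((\<tau> ^^ n) [A]) w"
  then show "w = (\<lambda>k. (\<tau> ^^ k) [A] ! k)"
    using length_\<tau>_pow by (auto simp: is_prefix_iff)
qed

lemma \<eta>_is_prefix: "is_prefix ((\<tau> ^^ n) [A]) \<eta>"
  using theI'[OF \<eta>_well_defined] by (simp only: \<eta>_def)

text \<open>The infinite word \<open>\<eta>\<close> is fixed by the extension of \<open>\<tau>\<close> to infinite words.\<close>

lemma \<eta>_fixed_point: "is_prefix (\<tau> (prefix n \<eta>)) \<eta>"
proof -
  let ?u = "(\<tau> ^^ n) [A]"
  have "prefix n \<eta> = take n ?u"
    using \<eta>_is_prefix[of n] length_\<tau>_pow[of n]
    by (intro nth_equalityI) (auto simp: is_prefix_iff)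
  then have "\<tau> ?u = \<tau> (prefix n \<eta>) @ \<tau> (drop n ?u)"
    by (simp only: \<tau>_append [symmetric] append_take_drop_id)
  moreover have "is_prefix (\<tau> ?u) \<eta>"
    using \<eta>_is_prefix[of "Suc n"] by simp
  ultimately show ?thesis
    by (simp add: is_prefix_iff nth_append)
qed

lemma run_q0_replicate_False: "run q0 (replicate k False @ ds) = run q0 ds"
  by (induction k) (simp_all add: run_def)

lemma digits_value_snoc: "digits_value (ds @ [d]) = 2 * digits_value ds + of_bool d"
proof -
  have "(\<Sum>j<length ds. of_bool ((ds @ [d]) ! j) * 2 ^ (length ds - j))
      = (\<Sum>j<length ds. 2 * (of_bool (ds ! j) * 2 ^ (length ds - 1 - j)) :: nat)"
  proof (rule sum.cong)
    fix j
    assume "j \<in> {..<length ds}"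
    then have "length ds - j = Suc (length ds - 1 - j)" and "j < length ds"
      by auto
    then show "of_bool ((ds @ [d]) ! j) * 2 ^ (length ds - j)
        = (2 * (of_bool (ds ! j) * 2 ^ (length ds - 1 - j)) :: nat)"
      by (simp only: nth_append power_Suc if_True mult.left_commute)
  qed simp
  then show ?thesis
    unfolding digits_value_def by (simp only: sum_distrib_left) simp
qed

lemma run_eq_if_digits_value_eq:
  assumes "digits_value ds = digits_value es"
  shows "run q0 ds = run q0 es"
  using assms
proof (induction "length ds + length es" arbitrary: ds es rule: less_induct)
  case less
  have zero: "run q0 fs = q0" if "digits_value fs = 0" for fs
  proof -
    have "fs = replicate (length fs) False"
      using that by (intro nth_equalityI) (auto simp: digits_value_def)
    then have "run q0 fs = run q0 (replicate (length fs) False @ [])"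
      by simp
    then show ?thesis
      unfolding run_q0_replicate_False by (simp add: run_def)
  qed
  show ?case
  proof (cases "ds = [] \<or> es = []")
    case True
    then have "digits_value ds = 0" "digits_value es = 0"
      using less.prems by (auto simp: digits_value_def)
    then show ?thesis
      by (simp add: zero)
  next
    case False
    then obtain ds' d es' e where eq: "ds = ds' @ [d]" "es = es' @ [e]"
      by (metis rev_exhaust)
    have *: "2 * digits_value ds' + of_bool d = 2 * digits_value es' + of_bool e"
      using less.prems unfolding eq digits_value_snoc .
    have "d = e"
      using arg_cong[OF *, of even] by (cases d; cases e) simp_all
    moreover from this have "digits_value ds' = digits_value es'"
      using * by simp
    then have "run q0 ds' = run q0 es'"
      by (intro less.hyps) (simp_all add: eq)
    ultimately show ?thesis
      by (simp add: eq run_def)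
  qed
qed

lemma binary_expansion_exists: "\<exists>ds. binary_expansion n ds"
proof (induction n rule: less_induct)
  case (less n)
  show ?case
  proof (cases "n = 0")
    case True
    then have "binary_expansion n [False]"
      by (simp add: binary_expansion_def digits_value_def)
    then show ?thesis ..
  next
    case False
    then obtain ds where "binary_expansion (n div 2) ds"
      using less.IH[of "n div 2"] by auto
    then have "digits_value (ds @ [odd n]) = 2 * (n div 2) + of_bool (odd n)"
      by (simp only: digits_value_snoc binary_expansion_def)
    then have "binary_expansion n (ds @ [odd n])"
      by (simp add: binary_expansion_def)
    then show ?thesis ..
  qed
qed

lemma automaton_seq_well_defined:
  "\<exists>!s. \<exists>ds. binary_expansion n ds \<and> s = label (run q0 ds)"
  using binary_expansion_exists[of n] run_eq_if_digits_value_eq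
  unfolding binary_expansion_def by metis

end

theory Submission
  imports Defs
begin

text \<open>The word \<open>\<eta>\<close> and the automatic sequence satisfy the same recursion: their value is \<open>A\<close> at
  \<open>2k\<close>, and at \<open>2k + 1\<close> it is the image of their value at \<open>k\<close> under the map that reading the digit 1
  induces on labels. For the automaton this is the effect of the last digit. For \<open>\<eta>\<close> it holds
  because inserting \<open>A\<close> before, between and after the images of the letters of \<open>\<tau>\<^sup>n(A)\<close> gives
  \<open>\<tau>\<^sup>n\<^sup>+\<^sup>1(A)\<close>; this in turn follows by induction from \<open>\<tau>\<^sup>n\<^sup>+\<^sup>1(A) = \<tau>\<^sup>n(A) \<tau>\<^sup>n(X) \<tau>\<^sup>n(A)\<close>, where
  \<open>\<tau>\<^sup>n(X)\<close> is a single letter.\<close>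

text \<open>On \<open>X\<close>, \<open>Y\<close>, \<open>Z\<close> this is the action of
  \<open>\<tau>\<close>; the value at \<open>A\<close> reflects the move from \<open>q0\<close> to
  \<open>q1\<close>.\<close>

fun next_letter :: "letter \<Rightarrow> letter" where
  "next_letter A = X"
| "next_letter X = Y"
| "next_letter Y = Z"
| "next_letter Z = X"

fun interleave_A :: "letter list \<Rightarrow> letter list" where
  "interleave_A [] = [A]"
| "interleave_A (c # w) = A # next_letter c # interleave_A w"

lemma interleave_A_append:
  "interleave_A (u @ c # v) = interleave_A u @ next_letter c # interleave_A v"
  by (induction u) simp_all

lemma nth_interleave_A_even: "k \<le> length w \<Longrightarrow> interleave_A w ! (2 * k) = A"
  by (induction w arbitrary: k; case_tac k) simp_all

lemma nth_interleave_A_odd: "k < length w \<Longrightarrow> interleave_A w ! Suc (2 * k) = next_letter (w ! k)"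
  by (induction w arbitrary: k; case_tac k) simp_all

lemma length_interleave_A: "length (interleave_A w) = Suc (2 * length w)"
  by (induction w) simp_all

lemma \<tau>_singleton: "c \<noteq> A \<Longrightarrow> \<tau> [c] = [next_letter c]"
  by (cases c) (simp_all add: \<tau>_def)

lemma \<tau>_pow_X: "(\<tau> ^^ n) [X] = [(next_letter ^^ n) X]"
proof (induction n)
  case (Suc n)
  \<comment> \<open>\<open>A\<close> is not a value of \<open>next_letter\<close>.\<close>
  have "(next_letter ^^ n) X \<noteq> A"
    by (cases n) (auto elim: next_letter.elims)
  then show ?case
    by (simp add: Suc.IH \<tau>_singleton)
qed simp

lemma \<tau>_pow_Suc_eq_interleave_A: "(\<tau> ^^ Suc n) [A] = interleave_A ((\<tau> ^^ n) [A])"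
proof (induction n)
  case 0
  show ?case
    by (simp add: \<tau>_def)
next
  case (Suc n)
  have "(\<tau> ^^ Suc (Suc n)) [A] = interleave_A ((\<tau> ^^ n) [A]) @
      (next_letter ^^ Suc n) X # interleave_A ((\<tau> ^^ n) [A])"
    by (simp only: \<tau>_pow_Suc[of "Suc n"] Suc.IH \<tau>_pow_X append_Cons append_Nil)
  \<comment> \<open>The middle letter is the \<open>next_letter\<close> image of the middle letter
    of \<open>(\<tau> ^^ Suc n) [A]\<close>.\<close>
  also have "\<dots> = interleave_A ((\<tau> ^^ Suc n) [A])"
    by (simp only: \<tau>_pow_Suc[of n] \<tau>_pow_X interleave_A_append append_Cons append_Nil
        funpow.simps(2)[of n next_letter] o_apply)
  finally show ?case .
qed

lemma \<eta>_eq_nth: "k < length ((\<tau> ^^ n) [A]) \<Longrightarrow> \<eta> k = (\<tau> ^^ n) [A] ! k"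
  using \<eta>_is_prefix[of n] by (simp only: is_prefix_iff)

lemma \<eta>_even: "\<eta> (2 * k) = A"
  \<comment> \<open>\<open>(\<tau> ^^ k) [A]\<close> has more than \<open>k\<close> letters, so
    interleaving it reaches past position \<open>2 * k\<close>.\<close>
  using \<eta>_eq_nth[of "2 * k" "Suc k"] length_\<tau>_pow[of k]
  by (simp add: \<tau>_pow_Suc_eq_interleave_A length_interleave_A nth_interleave_A_even
      del: funpow.simps)

lemma \<eta>_odd: "\<eta> (Suc (2 * k)) = next_letter (\<eta> k)"
  using \<eta>_eq_nth[of "Suc (2 * k)" "Suc k"] \<eta>_eq_nth[of k k] length_\<tau>_pow[of k]
  by (simp add: \<tau>_pow_Suc_eq_interleave_A length_interleave_A nth_interleave_A_odd
      del: funpow.simps)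

lemma label_step: "label (step q d) = (if d then next_letter (label q) else A)"
  by (cases q; cases d) simp_all

text \<open>Induction on digit lists, not numbers, handles leading zeros too.\<close>

lemma label_run_eq_\<eta>: "label (run q0 ds) = \<eta> (digits_value ds)"
proof (induction ds rule: rev_induct)
  case Nil
  show ?case
    using \<eta>_even[of 0] by (simp add: run_def digits_value_def)
next
  case (snoc d ds)
  have "label (run q0 (ds @ [d])) = label (step (run q0 ds) d)"
    by (simp add: run_def)
  then show ?case
    by (simp add: label_step digits_value_snoc snoc.IH \<eta>_even \<eta>_odd)
qed

theorem theorem2p15:
  shows "\<eta> = automaton_seq q0"
proof
  fix n
  obtain ds where ds: "binary_expansion n ds"
    using binary_expansion_exists by blast
  have "automaton_seq q0 n = label (run q0 ds)"
    unfolding automaton_seq_def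
    using ds by (intro the1_equality[OF automaton_seq_well_defined]) blast
  also have "\<dots> = \<eta> n"
    using ds by (simp add: label_run_eq_\<eta> binary_expansion_def)
  finally show "\<eta> n = automaton_seq q0 n" ..
qed

end
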